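(* Let $S\subset\mathbb{N}$ with $|S|=4$. Then Maker has a $5$-move strategy in the game for $S$.
   Context: Game for $S$: for a fixed finite set $S\subset\mathbb{N}$, two players, Maker and Breaker, alternately choose previously unchosen natural numbers, Maker choosing first. Maker wins as soon as the set of Maker's choices contains $aS+b$ for some $a\in\mathbb{N}\setminus\{0\}$ and $b\in\mathbb{Z}$. Maker has an $N$-move strategy if Maker has a strategy guaranteeing a win using at most $N$ selections, whatever Breaker does. *)

theory Defs
  imports Main
begin

text \<open>The multiplier is a positive natural number, while the translation may be negative; the copy
  itself must consist of natural numbers, hence the embedding of \<open>M\<close> into the integers.\<close>

definition contains_copy :: "nat set \<Rightarrow> nat set \<Rightarrow> bool" where
  "contains_copy S M \<longleftrightarrow>
     (\<exists>(a::nat) (b::int). a \<noteq> 0 \<and> (\<lambda>s. int a * int s + b) ` S \<subseteq> int ` M)"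

text \<open>A play is recorded as the sequence of all numbers chosen: Maker's choices are at the even
  positions, Breaker's at the odd ones. A winning position stays winning when more
  numbers are chosen, so plays are simply continued for ever after a win of Maker.\<close>

definition legal_play :: "(nat \<Rightarrow> nat) \<Rightarrow> bool" where
  "legal_play p \<longleftrightarrow> (\<forall>i. p i \<notin> p ` {..<i})"

definition maker_choices :: "(nat \<Rightarrow> nat) \<Rightarrow> nat \<Rightarrow> nat set" where
  "maker_choices p n = (\<lambda>i. p (2 * i)) ` {..<n}"

text \<open>A strategy maps the list of all choices made so far, oldest first, to a previously unchosen
  number. Since it has to answer every history legally, a strategy can never
  win vacuously by blocking the play.\<close>

definition maker_strategy :: "(nat list \<Rightarrow> nat) \<Rightarrow> bool" where
  "maker_strategy \<sigma> \<longleftrightarrow> (\<forall>h. \<sigma> h \<notin> set h)"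

definition follows :: "(nat list \<Rightarrow> nat) \<Rightarrow> (nat \<Rightarrow> nat) \<Rightarrow> bool" where
  "follows \<sigma> p \<longleftrightarrow> (\<forall>i. p (2 * i) = \<sigma> (map p [0..<2 * i]))"

definition maker_has_move_strategy :: "nat \<Rightarrow> nat set \<Rightarrow> bool" where
  "maker_has_move_strategy N S \<longleftrightarrow>
     (\<exists>\<sigma>. maker_strategy \<sigma> \<and>
        (\<forall>p. legal_play p \<and> follows \<sigma> p \<longrightarrow>
           (\<exists>n\<le>N. contains_copy S (maker_choices p n))))"

end

theory Submission
  imports Defs "HOL-Computational_Algebra.Primes"
begin

text \<open>Let \<open>p < q < c\<close> be the distances of the points of \<open>S\<close> from one of its end points. Maker first
  plays this end point \<open>O\<close>; from then on only copies fixing the end point at \<open>O\<close> matter, that is, the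
  sets \<open>{\<mu> p, \<mu> q, \<mu> c}\<close> of distances from \<open>O\<close>. Up to a scaling factor, take \<open>\<mu>\<close> a quadratic and
  the distances cubic monomials in \<open>p, q, c\<close>: these form a triangular array with the six
  winning triangles as cells. Maker's second move is its centre \<open>p q c\<close>. For each \<open>x\<close> among
  \<open>p, q, c\<close> there is a forced win through the three triangles whose \<open>\<mu>\<close> is divisible by \<open>x\<close>. If no
  two relevant monomials coincide, then Breaker's second choice cannot spoil
  all three of them; a prime valuation argument shows that a harmful coincidence cannot occur
  for both end points of \<open>S\<close>.\<close>

section \<open>Winning positions and strategies\<close>

text \<open>Backward induction with \<open>n\<close> counting Maker's remaining choices. The win is
  tested only at the end, after Breaker's last reply; this loses nothing, since further choices
  never destroy a copy.\<close>

fun wins_within :: "nat set \<Rightarrow> nat \<Rightarrow> nat set \<Rightarrow> nat set \<Rightarrow> bool" where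
  "wins_within S 0 M B \<longleftrightarrow> contains_copy S M"
| "wins_within S (Suc n) M B \<longleftrightarrow>
     (\<exists>m. m \<notin> M \<union> B \<and>
        (\<forall>b. b \<notin> insert m (M \<union> B) \<longrightarrow> wins_within S n (insert m M) (insert b B)))"

lemma wins_within_SucI:
  assumes "m \<notin> M" "m \<notin> B"
    and "\<And>b. b \<notin> insert m (M \<union> B) \<Longrightarrow> wins_within S n (insert m M) (insert b B)"
  shows "wins_within S (Suc n) M B"
  unfolding wins_within.simps using assms by (intro exI[of _ m]) simp

definition even_entries :: "nat list \<Rightarrow> nat set" where
  "even_entries h = (\<lambda>i. h ! (2 * i)) ` {i. 2 * i < length h}"

definition odd_entries :: "nat list \<Rightarrow> nat set" where
  "odd_entries h = (\<lambda>i. h ! (2 * i + 1)) ` {i. 2 * i + 1 < length h}"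

lemma set_eq_even_Un_odd: "set h = even_entries h \<union> odd_entries h"
proof
  show "set h \<subseteq> even_entries h \<union> odd_entries h"
  proof
    fix x assume "x \<in> set h"
    then obtain j where j: "j < length h" "h ! j = x"
      by (auto simp: in_set_conv_nth)
    show "x \<in> even_entries h \<union> odd_entries h"
    proof (cases "even j")
      case True
      then obtain i where "j = 2 * i" by (elim evenE)
      with j show ?thesis by (auto simp: even_entries_def)
    next
      case False
      then obtain i where "j = 2 * i + 1" by (elim oddE)
      with j show ?thesis by (auto simp: odd_entries_def)
    qed
  qed
qed (auto simp: even_entries_def odd_entries_def)

lemma even_entries_play: "even_entries (map p [0..<2 * n]) = maker_choices p n"
  unfolding even_entries_def maker_choices_def by (rule image_cong) auto

lemma odd_entries_play: "odd_entries (map p [0..<2 * n]) = (\<lambda>i. p (2 * i + 1)) ` {..<n}"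
  unfolding odd_entries_def by (rule image_cong) auto

text \<open>Choosing in every round a move that keeps the position winning makes this an invariant
  of the play; after \<open>N\<close> rounds it is the win itself.\<close>

lemma move_strategyI:
  assumes "wins_within S N {} {}"
  shows "maker_has_move_strategy N S"
proof -
  \<comment> \<open>\<open>length h div 2\<close> rounds are over in \<open>h\<close>, and the move
    \<open>m\<close> uses up one more.\<close>
  define good where "good h m \<longleftrightarrow> m \<notin> set h \<and>
      (\<forall>b. b \<notin> insert m (set h) \<longrightarrow>
        wins_within S (N - length h div 2 - 1) (insert m (even_entries h))
          (insert b (odd_entries h)))" for h m
  \<comment> \<open>Where no good move exists, any unchosen number serves: every history needs a
    legal answer.\<close>
  define \<sigma> where "\<sigma> h = (if \<exists>m. good h m then SOME m. good h m else SOME m. m \<notin> set h)" for h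
  have good: "good h (\<sigma> h)" if "\<exists>m. good h m" for h
    using someI_ex[OF that] that by (simp add: \<sigma>_def)
  have "\<sigma> h \<notin> set h" for h
  proof (cases "\<exists>m. good h m")
    case True
    then show ?thesis using good[of h] by (simp add: good_def)
  next
    case False
    moreover have "\<exists>m. m \<notin> set h"
      using ex_new_if_finite[OF infinite_UNIV_nat finite_set] .
    ultimately show ?thesis
      by (simp add: \<sigma>_def someI_ex[of "\<lambda>m. m \<notin> set h"])
  qed
  then have strat: "maker_strategy \<sigma>"
    by (simp add: maker_strategy_def)
  have win: "contains_copy S (maker_choices p N)" if p: "legal_play p" "follows \<sigma> p" for p
  proof -
    define H where "H n = map p [0..<2 * n]" for n
    have "wins_within S (N - n) (even_entries (H n)) (odd_entries (H n))" if "n \<le> N" for n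
      using that
    proof (induction n)
      case 0
      then show ?case using assms by (simp add: H_def even_entries_def odd_entries_def)
    next
      case (Suc n)
      then have eq: "N - n = Suc (N - Suc n)" by simp
      from Suc have "wins_within S (Suc (N - Suc n)) (even_entries (H n)) (odd_entries (H n))"
        by (simp flip: eq)
      then have "\<exists>m. good (H n) m"
        by (simp add: good_def set_eq_even_Un_odd H_def)
      then have g: "good (H n) (p (2 * n))"
        using good[of "H n"] p(2) by (simp add: follows_def H_def)
      have "p (2 * n + 1) \<notin> p ` {..<2 * n + 1}"
        using p(1) unfolding legal_play_def by blast
      moreover have "set (H n) = p ` {..<2 * n}"
        by (simp add: H_def lessThan_atLeast0)
      ultimately have "p (2 * n + 1) \<notin> insert (p (2 * n)) (set (H n))"
        by (auto simp: lessThan_Suc)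
      with g have "wins_within S (N - Suc n) (insert (p (2 * n)) (even_entries (H n)))
          (insert (p (2 * n + 1)) (odd_entries (H n)))"
        by (simp add: good_def H_def)
      then show ?case
        by (simp only: H_def even_entries_play odd_entries_play maker_choices_def
              lessThan_Suc image_insert)
    qed
    from this[of N] show ?thesis
      by (simp add: H_def even_entries_play)
  qed
  show ?thesis
    unfolding maker_has_move_strategy_def using strat win by blast
qed

section \<open>Threats\<close>

lemma contains_copy_mono: "contains_copy S M \<Longrightarrow> M \<subseteq> M' \<Longrightarrow> contains_copy S M'"
  unfolding contains_copy_def by (meson image_mono subset_trans)

text \<open>Surplus moves can be made anywhere; finiteness supplies unchosen numbers.\<close>

lemma wins_within_if_contains_copy:
  "finite M \<Longrightarrow> finite B \<Longrightarrow> contains_copy S M \<Longrightarrow> wins_within S n M B"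
proof (induction n arbitrary: M B)
  case (Suc n)
  obtain m where "m \<notin> M \<union> B"
    using ex_new_if_finite[OF infinite_UNIV_nat, of "M \<union> B"] Suc.prems by auto
  moreover have "wins_within S n (insert m M) (insert b B)" for b
    using Suc.prems contains_copy_mono[OF _ subset_insertI] by (intro Suc.IH) simp_all
  ultimately show ?case
    using wins_within_SucI[of m M B S n] by blast
qed simp

text \<open>Allowing \<open>t\<close> to be Maker's already absorbs coincidences such as
  \<open>z * z = x * y\<close>, where the later threat \<open>x * z * z\<close> is the earlier
  choice \<open>x * x * y\<close>.\<close>

lemma wins_within_threat:
  assumes "finite M" "finite B" "t \<notin> B" "contains_copy S (insert t M)"
  shows "wins_within S (Suc n) M B"
proof (cases "t \<in> M")
  case True
  then show ?thesis
    using assms wins_within_if_contains_copy[of M B S "Suc n"] by (simp add: insert_absorb)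
next
  case False
  then show ?thesis
    using assms wins_within_if_contains_copy[of "insert t M" _ S n] by auto
qed

lemma wins_within_double_threat:
  assumes "finite M" "finite B" "m \<notin> M" "m \<notin> B"
    and "t \<noteq> t'" "t \<notin> B" "t' \<notin> B"
    and "contains_copy S (insert t (insert m M))" "contains_copy S (insert t' (insert m M))"
  shows "wins_within S (Suc (Suc n)) M B"
proof -
  have "wins_within S (Suc n) (insert m M) (insert b B)" for b
  proof (cases "b = t")
    case True
    show ?thesis by (rule wins_within_threat[of _ _ t']) (use assms True in auto)
  next
    case False
    show ?thesis by (rule wins_within_threat[of _ _ t]) (use assms False in auto)
  qed
  then show ?thesis
    using assms(3,4) wins_within_SucI[of m M B S "Suc n"] by blast
qed

section \<open>The forced win at a pivot\<close>

text \<open>The points other than \<open>x * y * z\<close> of the triangles with multipliers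
  \<open>x * y\<close>, \<open>x * z\<close> and \<open>x * x\<close>.\<close>

definition pivot_points :: "nat \<Rightarrow> nat \<Rightarrow> nat \<Rightarrow> nat set" where
  "pivot_points x y z = {x * x * y, x * x * z, x * y * y, x * z * z, x * x * x}"

lemma triple_mult_le: "a \<le> c \<Longrightarrow> b \<le> c \<Longrightarrow> d \<le> c \<Longrightarrow> a * b * d \<le> c * c * (c::nat)"
  by (intro mult_le_mono)

text \<open>Maker threatens with \<open>x * x * y\<close>, which forces Breaker to \<open>x * y * y\<close>; then \<open>x * x * z\<close> makes
  the double threat \<open>x * z * z\<close> and \<open>x * x * x\<close>.\<close>

lemma wins_within_pivot:
  fixes g :: "nat \<Rightarrow> nat"
  assumes inj: "inj_on g {..c * c * c}"
    and pos: "0 < x" "0 < y" "0 < z" and le: "x \<le> c" "y \<le> c" "z \<le> c"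
    and ne: "x \<noteq> y" "x \<noteq> z" "y \<noteq> z" "y * y \<noteq> x * z"
    and copy: "\<And>\<mu> M. 0 < \<mu> \<Longrightarrow> \<mu> \<le> c * c \<Longrightarrow> g 0 \<in> M \<Longrightarrow>
        (\<lambda>s. g (\<mu> * s)) ` {x, y, z} \<subseteq> M \<Longrightarrow> contains_copy S M"
    and B: "finite B" "B \<inter> g ` pivot_points x y z = {}"
  shows "wins_within S 3 {g 0, g (x * y * z)} B"
proof -
  have g_eq: "g r = g s \<longleftrightarrow> r = s" if "r \<le> c * c * c" "s \<le> c * c * c" for r s
    using inj_on_eq_iff[OF inj] that by simp
  note bounds = le triple_mult_le
  have free: "g (x * x * y) \<notin> B" "g (x * x * z) \<notin> B" "g (x * y * y) \<notin> B"
    "g (x * z * z) \<notin> B" "g (x * x * x) \<notin> B"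
    using B(2) by (auto simp: pivot_points_def)
  have copy': "contains_copy S M"
    if "u \<in> {x, y, z}" "v \<in> {x, y, z}" "g 0 \<in> M"
      "g (u * v * x) \<in> M" "g (u * v * y) \<in> M" "g (u * v * z) \<in> M" for u v M
    using that pos le by (intro copy[of "u * v"]) (auto intro!: mult_le_mono)
  let ?M = "{g 0, g (x * y * z)}"
  have m3: "g (x * x * y) \<notin> ?M \<union> B"
    using free(1) pos ne by (simp add: g_eq bounds)
  have "wins_within S 2 (insert (g (x * x * y)) ?M) (insert b B)" for b
  proof (cases "b = g (x * y * y)")
    case False
    have "contains_copy S (insert (g (x * y * y)) (insert (g (x * x * y)) ?M))"
      by (rule copy'[of x y]) (auto simp: mult_ac)
    with False free B(1) show ?thesis
      unfolding numeral_2_eq_2 by (intro wins_within_threat[of _ _ "g (x * y * y)"]) auto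
  next
    case True
    \<comment> \<open>Breaker's forced reply must not occupy a point of the continuation; for
      \<open>x * x * z\<close> this is the assumption \<open>y * y \<noteq> x * z\<close>.\<close>
    have "y * y \<noteq> z * z" "y * y \<noteq> x * x"
      using ne by (simp_all flip: power2_eq_square)
    then have "x * z * z \<noteq> x * y * y" "x * x * x \<noteq> x * y * y" "x * x * z \<noteq> x * y * y"
      using pos ne by (simp_all add: mult.assoc)
    with True have "g (x * z * z) \<noteq> b" "g (x * x * x) \<noteq> b" "g (x * x * z) \<noteq> b"
      by (simp_all add: g_eq bounds)
    moreover have "z * z \<noteq> x * x"
      using ne by (simp flip: power2_eq_square)
    then have "x * z * z \<noteq> x * x * x"
      using pos by (simp add: mult.assoc)
    then have "g (x * z * z) \<noteq> g (x * x * x)"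
      by (simp add: g_eq bounds)
    moreover have "g (x * x * z) \<notin> insert (g (x * x * y)) ?M"
      using pos ne by (simp add: g_eq bounds)
    moreover have "contains_copy S
        (insert (g (x * z * z)) (insert (g (x * x * z)) (insert (g (x * x * y)) ?M)))"
      by (rule copy'[of x z]) (auto simp: mult_ac)
    moreover have "contains_copy S
        (insert (g (x * x * x)) (insert (g (x * x * z)) (insert (g (x * x * y)) ?M)))"
      by (rule copy'[of x x]) (auto simp: mult_ac)
    ultimately show ?thesis
      using free B(1) unfolding numeral_2_eq_2
      by (intro wins_within_double_threat[of _ _ "g (x * x * z)" "g (x * z * z)" "g (x * x * x)"])
        auto
  qed
  then have "wins_within S (Suc 2) ?M B"
    using m3 wins_within_SucI[of "g (x * x * y)" ?M B S 2] by blast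
  then show ?thesis by simp
qed

text \<open>The coincidences of cubic monomials that let a single number lie in all three sets of pivot
  points.\<close>

definition collision :: "nat \<Rightarrow> nat \<Rightarrow> nat \<Rightarrow> bool" where
  "collision p q c \<longleftrightarrow> q * q = p * c \<or> q * q * q = p * p * c \<or> q * q * q = p * c * c"

section \<open>Comparing monomials and excluding coincidences\<close>

lemma triple_mult_less:
  fixes a b d :: nat
  assumes "0 < a" "0 < b" "0 < d" "a \<le> a'" "b \<le> b'" "d \<le> d'" "a < a' \<or> b < b' \<or> d < d'"
  shows "a * b * d < a' * b' * d'"
proof (cases "d < d'")
  case True
  then show ?thesis using assms by (intro mult_le_less_imp_less mult_le_mono) auto
next
  case False
  then have "a * b < a' * b'"
    using assms by (auto intro: mult_less_le_imp_less mult_le_less_imp_less)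
  then show ?thesis using assms by (intro mult_less_le_imp_less[of "a * b"]) auto
qed

text \<open>By size, the sets for \<open>p\<close> and \<open>c\<close> can share only the values
  \<open>p * p * c\<close> and \<open>p * c * c\<close>; such a value lies in the set for
  \<open>q\<close> only through a collision.\<close>

lemma pivot_points_disjoint:
  assumes pq: "0 < p" "p < q" "q < c" and nc: "\<not> collision p q c"
  shows "pivot_points p c q \<inter> pivot_points q c p \<inter> pivot_points c p q = {}"
proof -
  have lt: "p * p * p < p * p * q" "p * p * q < p * q * q" "p * q * q < q * q * q"
    "q * q * q < q * q * c" "q * q * c < q * c * c" "q * c * c < c * c * c"
    "p * p * q < p * p * c" "p * p * c < p * c * c" "p * p * c < q * q * c"
    "p * q * q < p * c * c" "p * c * c < q * c * c"
    using pq by (simp_all only: triple_mult_less less_imp_le order.refl simp_thms less_trans[of p q c] less_trans[of 0 p])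
  \<comment> \<open>The first two are \<open>q * q \<noteq> p * c\<close> multiplied by
    \<open>p\<close> and by \<open>c\<close>; the others are the remaining cases of
    \<open>collision\<close>.\<close>
  have ne: "p * p * c \<noteq> p * q * q" "q * q * c \<noteq> p * c * c"
    "q * q * q \<noteq> p * p * c" "q * q * q \<noteq> p * c * c"
    using nc pq unfolding collision_def by (simp_all add: mult.assoc)
  have False
    if "r \<in> pivot_points p c q" "r \<in> pivot_points q c p" "r \<in> pivot_points c p q" for r
  proof -
    have "r = p * p * c \<or> r = p * p * q \<or> r = p * c * c \<or> r = p * q * q \<or> r = p * p * p"
      using that(1) by (simp add: pivot_points_def)
    moreover have "r = p * c * c \<or> r = q * c * c \<or> r = p * p * c \<or> r = q * q * c \<or> r = c * c * c"
      using that(3) by (simp add: pivot_points_def mult_ac)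
    ultimately have "r = p * p * c \<or> r = p * c * c"
      using lt by (elim disjE) linarith+
    moreover have "r = q * q * c \<or> r = p * q * q \<or> r = q * c * c \<or> r = p * p * q \<or> r = q * q * q"
      using that(2) by (simp add: pivot_points_def mult_ac)
    ultimately show False
      using lt ne by (elim disjE) (linarith | use ne in metis)+
  qed
  then show ?thesis by blast
qed

text \<open>Multiplicity at a prime turns products into sums, so each monomial equation becomes
  linear.\<close>

lemma collision_multiplicity:
  assumes "prime l" "0 < p" "0 < q" "0 < c" "collision p q c"
  defines "v \<equiv> multiplicity l"
  shows "2 * v q = v p + v c \<or> 3 * v q = 2 * v p + v c \<or> 3 * v q = v p + 2 * v c"
proof -
  have "v (a * b) = v a + v b" if "0 < a" "0 < b" for a b
    unfolding v_def using that assms(1) by (intro prime_elem_multiplicity_mult_distrib) auto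
  then have "v (q * q) = 2 * v q" "v (q * q * q) = 3 * v q" "v (p * c) = v p + v c"
    "v (p * p * c) = 2 * v p + v c" "v (p * c * c) = v p + 2 * v c"
    using assms by simp_all
  then show ?thesis using assms(5) unfolding collision_def by metis
qed

text \<open>Take a prime \<open>l\<close> occurring in \<open>c\<close> to a higher power than in \<open>p\<close>. A collision makes the
  multiplicity of the middle distance a weighted mean of the outer two, so \<open>q\<close> and \<open>c - q\<close> beat
  \<open>p\<close> as well, and the second collision passes this on to \<open>c - p\<close> and hence to \<open>p\<close>.\<close>

lemma not_collision_both_ends:
  assumes "0 < p" "p < q" "q < c"
  shows "\<not> collision p q c \<or> \<not> collision (c - q) (c - p) c"
proof (rule ccontr)
  assume "\<not> ?thesis"
  then have col: "collision p q c" "collision (c - q) (c - p) c" by auto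
  have "\<not> c dvd p" using assms by (auto dest: dvd_imp_le)
  then obtain l where l: "prime l" "multiplicity l p < multiplicity l c"
    using multiplicity_le_imp_dvd[of c p] assms
    by (metis gr_implies_not0 linorder_not_le)
  \<comment> \<open>Stated as divisibility by \<open>l ^ m\<close>, the bound passes to
    differences.\<close>
  define m where "m = Suc (multiplicity l p)"
  have dvd: "l ^ m dvd a \<longleftrightarrow> m \<le> multiplicity l a" if "0 < a" for a
    using that l(1) by (intro power_dvd_iff_le_multiplicity) auto
  have "m \<le> multiplicity l q"
    using collision_multiplicity[OF l(1) _ _ _ col(1)] l(2) assms by (auto simp: m_def)
  moreover have c: "m \<le> multiplicity l c" using l(2) by (simp add: m_def)
  ultimately have "l ^ m dvd c - q"
    using assms by (intro dvd_diff_nat) (simp_all add: dvd)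
  then have "m \<le> multiplicity l (c - q)" using assms by (simp add: dvd)
  then have "m \<le> multiplicity l (c - p)"
    using collision_multiplicity[OF l(1) _ _ _ col(2)] c assms by auto
  then have "l ^ m dvd c" "l ^ m dvd c - p"
    using c assms by (simp_all add: dvd)
  then have "l ^ m dvd c - (c - p)"
    by (rule dvd_diff_nat)
  then have "l ^ m dvd p" using assms by simp
  then have "m \<le> multiplicity l p" using dvd assms(1) by blast
  then show False by (simp add: m_def)
qed

section \<open>The five moves from one end point\<close>

text \<open>\<open>f\<close> turns distances from the end point into numbers, so that one argument
  serves both ends. The bound is the largest monomial bound \<open>c * c * c\<close> times the
  larger scaling factor.\<close>

lemma wins_within_5:
  fixes f :: "nat \<Rightarrow> nat"
  assumes pq: "0 < p" "p < q" "q < c" and nc: "\<not> collision p q c"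
    and inj: "inj_on f {..(c * c * c + 1) * (c * c * c)}"
    and copy: "\<And>\<mu> M. 0 < \<mu> \<Longrightarrow> \<mu> * c \<le> (c * c * c + 1) * (c * c * c) \<Longrightarrow> f 0 \<in> M \<Longrightarrow>
        (\<lambda>s. f (\<mu> * s)) ` {p, q, c} \<subseteq> M \<Longrightarrow> contains_copy S M"
  shows "wins_within S 5 {} {}"
proof -
  let ?C = "c * c * c"
  have f_eq: "f r = f s \<longleftrightarrow> r = s" if "r \<le> (?C + 1) * ?C" "s \<le> (?C + 1) * ?C" for r s
    using inj_on_eq_iff[OF inj] that by simp
  have after1: "wins_within S 4 {f 0} {b1}" if b1: "b1 \<noteq> f 0" for b1
  proof -
    \<comment> \<open>The scaled arrays for the two values of \<open>k\<close> are disjoint, so Breaker's first choice misses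
      one of them.\<close>
    obtain k where k: "k = 1 \<or> k = ?C + 1" and kb: "b1 \<notin> (\<lambda>r. f (k * r)) ` {1..?C}"
    proof (cases "b1 \<in> f ` {1..?C}")
      case True
      then obtain s where s: "b1 = f s" "1 \<le> s" "s \<le> ?C" by auto
      have "b1 \<noteq> f ((?C + 1) * r)" if "1 \<le> r" "r \<le> ?C" for r
      proof -
        have "?C + 1 \<le> (?C + 1) * r" using mult_le_mono2[OF that(1), of "?C + 1"] by simp
        then have "s \<noteq> (?C + 1) * r" using s by linarith
        moreover have "(?C + 1) * r \<le> (?C + 1) * ?C" using that(2) by (rule mult_le_mono2)
        moreover have "s \<le> (?C + 1) * ?C" using s by simp
        ultimately show ?thesis using s f_eq by blast
      qed
      then have "b1 \<notin> (\<lambda>r. f ((?C + 1) * r)) ` {1..?C}"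
        by (simp only: image_iff Bex_def atLeastAtMost_iff) blast
      then show ?thesis using that by blast
    next
      case False
      then show ?thesis using that[of 1] by auto
    qed
    have kpos: "0 < k" using k by auto
    have kle: "k * r \<le> (?C + 1) * ?C" if "r \<le> ?C" for r
      using k that by (intro mult_le_mono) auto
    define g where "g r = f (k * r)" for r
    have g0: "g 0 = f 0" by (simp add: g_def)
    have g_eq: "g r = g s \<longleftrightarrow> r = s" if "r \<le> ?C" "s \<le> ?C" for r s
      using f_eq[OF kle[OF that(1)] kle[OF that(2)]] kpos by (simp add: g_def)
    then have inj_g: "inj_on g {..?C}"
      by (simp add: inj_on_def)
    have copy_g: "contains_copy S M"
      if "0 < \<mu>" "\<mu> \<le> c * c" "g 0 \<in> M" "(\<lambda>s. g (\<mu> * s)) ` {x, y, z} \<subseteq> M"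
        "{x, y, z} = {p, q, c}" for \<mu> M x y z
    proof (rule copy[of "k * \<mu>"])
      show "0 < k * \<mu>" using kpos that by simp
      have "\<mu> * c \<le> ?C" using that(2) by (rule mult_le_mono1)
      from kle[OF this] show "k * \<mu> * c \<le> (?C + 1) * ?C" by (simp add: mult.assoc)
      show "f 0 \<in> M" using that g0 by simp
      show "(\<lambda>s. f (k * \<mu> * s)) ` {p, q, c} \<subseteq> M"
        using that(4) unfolding that(5) by (simp add: g_def mult.assoc)
    qed
    have b1g: "b1 \<noteq> g r" if "0 < r" "r \<le> ?C" for r
      using kb that by (auto simp: g_def)
    have le: "p \<le> c" "q \<le> c" "c \<le> c" and pos: "0 < p" "0 < q" "0 < c" using pq by auto
    have piv: "r \<le> ?C \<and> 0 < r" if "r \<in> pivot_points x y z" "{x, y, z} = {p, q, c}" for r x y z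
    proof -
      have "x \<in> {p, q, c}" "y \<in> {p, q, c}" "z \<in> {p, q, c}" using that(2) by auto
      then have "x \<le> c \<and> 0 < x" "y \<le> c \<and> 0 < y" "z \<le> c \<and> 0 < z" using pq by auto
      with that(1) show ?thesis
        unfolding pivot_points_def by (auto intro: triple_mult_le)
    qed
    have m2: "g (p * q * c) \<notin> {f 0} \<union> {b1}"
      using b1g[of "p * q * c"] pos le triple_mult_le[OF le] by (auto simp: g_eq simp flip: g0)
    have win: "wins_within S 3 {g 0, g (p * q * c)} {b2, b1}"
      if xyz: "{x, y, z} = {p, q, c}" "x * y * z = p * q * c" "x \<noteq> y" "x \<noteq> z" "y \<noteq> z"
        "y * y \<noteq> x * z" and b2: "b2 \<notin> g ` pivot_points x y z" for x y z b2
    proof -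
      have "x \<in> {p, q, c}" "y \<in> {p, q, c}" "z \<in> {p, q, c}" using xyz(1) by auto
      then have "x \<le> c" "0 < x" "y \<le> c" "0 < y" "z \<le> c" "0 < z" using pq by auto
      moreover have "{b2, b1} \<inter> g ` pivot_points x y z = {}"
        using b2 b1g piv xyz(1) by blast
      ultimately have "wins_within S 3 {g 0, g (x * y * z)} {b2, b1}"
        using xyz copy_g by (intro wins_within_pivot[OF inj_g]) auto
      then show ?thesis by (simp only: xyz(2))
    qed
    have "wins_within S 3 {g 0, g (p * q * c)} {b2, b1}" for b2
    proof -
      have sets: "{p, c, q} = {p, q, c}" "{q, c, p} = {p, q, c}" "{c, p, q} = {p, q, c}" by auto
      \<comment> \<open>By injectivity of \<open>g\<close>, a choice hitting all three sets would
        come from one common monomial.\<close>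
      have "b2 \<notin> g ` pivot_points p c q \<or> b2 \<notin> g ` pivot_points q c p
          \<or> b2 \<notin> g ` pivot_points c p q"
      proof (rule ccontr)
        assume "\<not> ?thesis"
        then obtain r s t where "b2 = g r" "b2 = g s" "b2 = g t"
          and mem: "r \<in> pivot_points p c q" "s \<in> pivot_points q c p" "t \<in> pivot_points c p q"
          by blast
        then have "r = s" "r = t"
          using g_eq piv[OF mem(1) sets(1)] piv[OF mem(2) sets(2)] piv[OF mem(3) sets(3)]
          by metis+
        with mem show False
          using pivot_points_disjoint[OF pq nc] by blast
      qed
      \<comment> \<open>The order of the arguments at each pivot is chosen so that
        \<open>y * y \<noteq> x * z\<close> follows from size alone.\<close>
      moreover have "p * q < c * c" "q * p < c * c" "p * p < c * q"
        using pq by (auto intro: mult_strict_mono)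
      ultimately show ?thesis
        using win[OF sets(1), of b2] win[OF sets(2), of b2] win[OF sets(3), of b2] pq
        by (auto simp: mult_ac)
    qed
    then have "wins_within S (Suc 3) {f 0} {b1}"
      using m2 g0 by (intro wins_within_SucI[of "g (p * q * c)"]) (simp_all add: insert_commute)
    then show ?thesis by simp
  qed
  have "wins_within S (Suc 4) {} {}"
    using after1 by (intro wins_within_SucI[of "f 0"]) auto
  then show ?thesis by simp
qed

section \<open>Choosing the end point\<close>

lemma card_4_nat_obtain:
  assumes "card (S::nat set) = 4"
  obtains s p q c where "S = {s, s + p, s + q, s + c}" "0 < p" "p < q" "q < c"
proof -
  have fin: "finite S" using assms by (intro card_ge_0_finite) simp
  define xs where "xs = sorted_list_of_set S"
  have "length xs = 4" using assms by (simp add: xs_def)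
  then obtain s0 s1 s2 s3 where xs: "xs = [s0, s1, s2, s3]"
    by (auto simp: eval_nat_numeral length_Suc_conv)
  have "sorted xs" "distinct xs" by (simp_all add: xs_def)
  then have lt: "s0 < s1" "s1 < s2" "s2 < s3" by (simp_all add: xs)
  have "S = {s0, s1, s2, s3}" using fin set_sorted_list_of_set[of S] by (simp flip: xs_def add: xs)
  with lt show ?thesis
    by (intro that[of s0 "s1 - s0" "s2 - s0" "s3 - s0"]) auto
qed

theorem theorem4p2:
  fixes S :: "nat set"
  assumes "card S = 4"
  shows "maker_has_move_strategy 5 S"
proof (rule move_strategyI)
  obtain s p q c where S: "S = {s, s + p, s + q, s + c}" and pq: "0 < p" "p < q" "q < c"
    using card_4_nat_obtain[OF assms] .
  show "wins_within S 5 {} {}"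
  proof (cases "collision p q c")
    case False
    show ?thesis
    proof (rule wins_within_5[OF pq False, where f = "\<lambda>r. r"])
      fix \<mu> :: nat and M
      assume "0 < \<mu>" "0 \<in> M" "(\<lambda>s. \<mu> * s) ` {p, q, c} \<subseteq> M"
      then have "int ` {0, \<mu> * p, \<mu> * q, \<mu> * c} \<subseteq> int ` M"
        by (intro image_mono) auto
      \<comment> \<open>The translation sends the least point \<open>s\<close> to 0.\<close>
      also have "int ` {0, \<mu> * p, \<mu> * q, \<mu> * c} = (\<lambda>t. int \<mu> * int t + - int (\<mu> * s)) ` S"
        by (simp add: S algebra_simps)
      finally show "contains_copy S M"
        unfolding contains_copy_def using \<open>0 < \<mu>\<close> by blast
    qed simp
  next
    case True
    \<comment> \<open>The largest point of \<open>S\<close> is now played at \<open>?R\<close>, far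
      enough from 0 that subtracting any relevant distance is not truncated.\<close>
    let ?R = "(c * c * c + 1) * (c * c * c)"
    have col: "\<not> collision (c - q) (c - p) c"
      using not_collision_both_ends[OF pq] True by simp
    have pos: "0 < c - q" "c - q < c - p" "c - p < c" using pq by auto
    show ?thesis
    proof (rule wins_within_5[OF pos col, where f = "\<lambda>r. ?R - r"])
      show "inj_on (\<lambda>r. ?R - r) {..?R}" by (auto simp: inj_on_def)
      fix \<mu> :: nat and M
      assume \<mu>: "0 < \<mu>" "\<mu> * c \<le> ?R" "?R - 0 \<in> M"
        "(\<lambda>s. ?R - \<mu> * s) ` {c - q, c - p, c} \<subseteq> M"
      have "\<mu> * (c - p) \<le> ?R" "\<mu> * (c - q) \<le> ?R"
        using \<mu>(2) mult_le_mono2[of "c - p" c \<mu>] mult_le_mono2[of "c - q" c \<mu>] by linarith+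
      \<comment> \<open>The translation sends \<open>s + c\<close> to \<open>?R\<close>.\<close>
      then have "(\<lambda>t. int \<mu> * int t + (int ?R - int (\<mu> * (s + c)))) ` S
          = int ` {?R - 0, ?R - \<mu> * (c - q), ?R - \<mu> * (c - p), ?R - \<mu> * c}"
        using \<mu>(2) pq by (simp only: S image_insert image_empty of_nat_diff)
          (auto simp: of_nat_diff algebra_simps)
      also have "\<dots> \<subseteq> int ` M" using \<mu> by (intro image_mono) auto
      finally show "contains_copy S M"
        unfolding contains_copy_def using \<mu>(1) by blast
    qed
  qed
qed

end
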